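(* For every fixed $r\ge 2$, $\mathrm{sat}_\circlearrowright(n,M_1^{(r)})=(1+o(1))\binom{n}{r-1}$ as $n\to\infty$. Moreover: (i) for every $n\ge 4$, every $M_1^{(2)}$-saturated $2$-cgh on $\Omega_n$ has exactly $n$ edges; (ii) for every $n\ge 6$, $\mathrm{sat}_\circlearrowright(n,M_1^{(3)})=\binom{n-1}{2}+3n-11$, and for every $n>6$ the $3$-cgh $H_n^{(3)}$ is, up to isomorphism, the unique $M_1^{(3)}$-saturated $3$-cgh on $\Omega_n$ with this number of edges.
   Context: A convex geometric hypergraph (cgh) on $\Omega_n=\{v_0,\dots,v_{n-1}\}$ is a family of subsets (edges) of $\Omega_n$, where the vertices carry the cyclic order $v_0<v_1<\dots<v_{n-1}<v_0$ (think of points placed clockwise on a circle; indices are taken mod $n$). It is an $r$-cgh if all edges have size $r$. Two cghs are isomorphic if there is a bijection between their vertex sets preserving the cyclic order and inducing a bijection between edge sets. For an $r$-cgh $F$, $H$ contains a copy of $F$ if there is an injection of the vertex set of $F$ into $\Omega_n$ preserving cyclic order and mapping every edge of $F$ to an edge of $H$; $H$ is $F$-free if it contains no copy of $F$. $H\subseteq\binom{\Omega_n}{r}$ is $F$-saturated if it is $F$-free and for every $e\in\binom{\Omega_n}{r}\setminus H$, $H\cup\{e\}$ contains a copy of $F$. $\mathrm{sat}_\circlearrowright(n,F)$ is the minimum number of edges of an $F$-saturated $r$-cgh on $\Omega_n$. $M_1^{(r)}$ is the $r$-cgh on $\Omega_{2r}$ with the two edges $\{v_0,\dots,v_{r-1}\}$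 and $\{v_r,\dots,v_{2r-1}\}$ (two geometrically disjoint edges). For vertices $v_i\neq v_j$, $(v_i,v_j)$ denotes the set of vertices strictly between $v_i$ and $v_j$ when moving clockwise (increasing index mod $n$) from $v_i$ to $v_j$, and $[v_i,v_j]=(v_i,v_j)\cup\{v_i,v_j\}$. Define $$H_n^{(r)}=\Big\{h\in\tbinom{\Omega_n}{r}: v_0\in h\Big\}\cup\bigcup_{j=1}^{r-1}\Big\{h\in\tbinom{\Omega_n}{r}: v_j\in h,\ h\cap[v_{n-r+j},v_{n-1}]\neq\emptyset\Big\}.$$ For example $H_n^{(3)}$ consists of all triples containing $v_0$ together with all triples containing one of the pairs $\{v_1,v_{n-2}\},\{v_1,v_{n-1}\},\{v_2,v_{n-1}\}$. *)

theory Defs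
  imports Main "HOL-Library.Landau_Symbols"
begin

text \<open>Vertices of \<Omega>_n are 0,...,n-1 (v_i is i), with the cyclic order 0 < 1 < ... < n-1 < 0.
  A cgh on \<Omega>_n is a set of subsets of {0..<n}.\<close>

text \<open>A map f from \<Omega>_m to \<Omega>_n preserves the cyclic order iff after some rotation of \<Omega>_n
  the sequence f 0, ..., f (m-1) is strictly increasing.\<close>
definition cyc_order_pres :: "nat \<Rightarrow> nat \<Rightarrow> (nat \<Rightarrow> nat) \<Rightarrow> bool" where
  "cyc_order_pres m n f \<longleftrightarrow>
     (\<exists>c. \<forall>i j. i < j \<and> j < m \<longrightarrow> (f i + c) mod n < (f j + c) mod n)"

definition contains_copy :: "nat \<Rightarrow> nat set set \<Rightarrow> nat \<Rightarrow> nat set set \<Rightarrow> bool" where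
  "contains_copy n H m F \<longleftrightarrow>
     (\<exists>f. f ` {0..<m} \<subseteq> {0..<n} \<and> inj_on f {0..<m} \<and> cyc_order_pres m n f
          \<and> (\<forall>e\<in>F. f ` e \<in> H))"

definition r_sets :: "nat \<Rightarrow> nat \<Rightarrow> nat set set" where
  "r_sets n r = {h. h \<subseteq> {0..<n} \<and> card h = r}"

definition saturated :: "nat \<Rightarrow> nat \<Rightarrow> nat \<Rightarrow> nat set set \<Rightarrow> nat set set \<Rightarrow> bool" where
  "saturated n r m F H \<longleftrightarrow>
     H \<subseteq> r_sets n r \<and> \<not> contains_copy n H m F
     \<and> (\<forall>e \<in> r_sets n r - H. contains_copy n (insert e H) m F)"

definition sat_cyc :: "nat \<Rightarrow> nat \<Rightarrow> nat \<Rightarrow> nat set set \<Rightarrow> nat" where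
  "sat_cyc n r m F = Min (card ` {H. saturated n r m F H})"

definition M1 :: "nat \<Rightarrow> nat set set" where
  "M1 r = {{0..<r}, {r..<2*r}}"

definition cgh_iso :: "nat \<Rightarrow> nat set set \<Rightarrow> nat set set \<Rightarrow> bool" where
  "cgh_iso n H H' \<longleftrightarrow>
     (\<exists>f. bij_betw f {0..<n} {0..<n} \<and> cyc_order_pres n n f \<and> (\<lambda>e. f ` e) ` H = H')"

definition Hnr :: "nat \<Rightarrow> nat \<Rightarrow> nat set set" where
  "Hnr n r = {h \<in> r_sets n r. 0 \<in> h}
     \<union> (\<Union>j\<in>{1..r-1}. {h \<in> r_sets n r. j \<in> h \<and> h \<inter> {n-r+j..n-1} \<noteq> {}})"

end

theory Submission
  imports Defs
begin

text \<open>
  Call an arc of consecutive vertices full if it contains an edge of the saturated family \<open>H\<close>.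
  Saturation means that of an arc and its complement exactly one is full, and that the non-edges
  are the \<open>r\<close>-sets contained in some non-full arc. Such an \<open>r\<close>-set has a unique non-full hull (an arc
  whose two end vertices belong to the set). With \<open>N k\<close> the number of full arcs of length \<open>k\<close>, this
  counts the non-edges as the sum over \<open>k\<close> of \<open>N (n - k) * ((k - 2) choose (r - 2))\<close>.
  Since \<open>N k + N (n - k) = n\<close> and the binomial weights increase with \<open>k\<close>, there are most non-edges when
  \<open>N k\<close> is as large as possible for all \<open>k \<le> n / 2\<close>. Disjoint arcs are not both full, so Katona's
  cycle argument gives \<open>N k \<le> k\<close> there, and \<open>Hnr n r\<close> attains this for \<open>r \<le> k\<close>: it is extremal for
  every \<open>r\<close>. For \<open>r = 2\<close> all weights are 1 and the count does not depend on \<open>H\<close>; for \<open>r = 3\<close> equality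
  forces three full arcs of length 3 through a common vertex, which determine \<open>H\<close>.
\<close>

section \<open>Rotated coordinates on the circle\<close>

text \<open>The rotation is added, as in \<open>cyc_order_pres\<close>, which avoids subtraction of
  natural numbers.\<close>

definition pos :: "nat \<Rightarrow> nat \<Rightarrow> nat \<Rightarrow> nat" where
  "pos n c v = (v + c) mod n"

lemma pos_less: "n > 0 \<Longrightarrow> pos n c v < n"
  by (simp add: pos_def)

lemma pos_mod: "pos n (c mod n) v = pos n c v"
  by (simp add: pos_def mod_add_right_eq)

lemma pos_add: "pos n (c + d) v = (pos n c v + d) mod n"
  by (simp add: pos_def mod_simps add.assoc)

lemma mod_less_double: "(x::nat) < 2 * n \<Longrightarrow> x mod n = (if x < n then x else x - n)"
  by (auto simp: mod_if)

lemma pos_add_if: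
  assumes "n > 0" "d \<le> n"
  shows "pos n (c + d) v = (if pos n c v + d < n then pos n c v + d else pos n c v + d - n)"
  unfolding pos_add by (rule mod_less_double) (use assms pos_less[of n c v] in linarith)

lemma pos_bij: assumes "n > 0" shows "bij_betw (pos n c) {0..<n} {0..<n}"
proof -
  have inj: "inj_on (pos n c) {0..<n}"
  proof (rule inj_onI)
    fix x y assume xy: "x \<in> {0..<n}" "y \<in> {0..<n}" "pos n c x = pos n c y"
    have "pos n c x = (x + c mod n) mod n" "pos n c y = (y + c mod n) mod n"
      by (simp_all add: pos_def mod_simps)
    moreover have "c mod n < n" using assms by simp
    ultimately show "x = y" using xy mod_less_double[of "x + c mod n" n] mod_less_double[of "y + c mod n" n]
      by (auto split: if_splits)
  qed
  moreover have "pos n c ` {0..<n} \<subseteq> {0..<n}" using assms by (auto simp: pos_less)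
  ultimately show ?thesis
    by (simp add: bij_betw_def card_image card_subset_eq)
qed

text \<open>The coordinates \<open>k, ..., n - 1\<close> become \<open>0, ..., n - k - 1\<close>, so
  adding \<open>n - k\<close> to \<open>c\<close> turns an arc of length \<open>k\<close> into its
  complement.\<close>

lemma pos_complement:
  assumes "n > 0" "k \<le> n"
  shows "pos n (c + (n - k)) v = (if pos n c v < k then pos n c v + n - k else pos n c v - k)"
  using pos_add_if[OF assms(1), of "n - k" c v] assms(2) by auto

lemma ex_preimage:
  assumes "n > 0" "P \<subseteq> {..<n}"
  obtains e where "e \<subseteq> {0..<n}" "pos n c ` e = P" "card e = card P"
proof -
  have bij: "bij_betw (pos n c) {0..<n} {0..<n}" by (rule pos_bij[OF assms(1)])
  then obtain e where e: "e \<subseteq> {0..<n}" "P = pos n c ` e"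
    using assms(2) by (metis bij_betw_imp_surj_on lessThan_atLeast0 subset_imageE)
  with bij have "card e = card P" by (metis bij_betw_def card_image inj_on_subset)
  with e that show ?thesis by blast
qed

text \<open>Two arcs with different origins are compared by expressing both in one coordinate;
  \<open>d\<close> is the offset between the origins.\<close>

lemma shift_exists:
  assumes "n > 0"
  obtains d where "d < n" "\<And>v. pos n c' v = pos n (c + d) v" "c' mod n = (c + d) mod n"
proof
  let ?d = "(c' + (n - c mod n)) mod n"
  show "?d < n" using assms by simp
  have "(c + ?d) mod n = (c mod n + (c' + (n - c mod n))) mod n" by (simp add: mod_simps)
  also have "c mod n + (c' + (n - c mod n)) = c' + n"
    using assms mod_less_divisor[of n c] by linarith
  finally show *: "c' mod n = (c + ?d) mod n" by simp
  show "pos n c' v = pos n (c + ?d) v" for v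
    using * by (metis pos_mod)
qed

text \<open>\<open>pos n c v < k\<close> says that \<open>v\<close> lies on the arc of length \<open>k\<close> that starts at the vertex \<open>- c mod n\<close>.\<close>

definition separated :: "nat \<Rightarrow> nat set \<Rightarrow> nat set \<Rightarrow> bool" where
  "separated n e e' \<longleftrightarrow> (\<exists>c k. k \<le> n \<and> (\<forall>v\<in>e. pos n c v < k) \<and> (\<forall>v\<in>e'. k \<le> pos n c v))"

lemma separated_sym:
  assumes "n > 0" "separated n e e'"
  shows "separated n e' e"
proof -
  from assms(2) obtain c k where *: "k \<le> n" "\<forall>v\<in>e. pos n c v < k" "\<forall>v\<in>e'. k \<le> pos n c v"
    by (auto simp: separated_def)
  have p: "pos n (c + (n - k)) v = (if pos n c v < k then pos n c v + n - k else pos n c v - k)" for v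
    by (rule pos_complement[OF assms(1) *(1)])
  have "pos n (c + (n - k)) v < n - k" if "v \<in> e'" for v
    using that * p[of v] pos_less[OF assms(1), of c v] by auto
  moreover have "n - k \<le> pos n (c + (n - k)) v" if "v \<in> e" for v
    using that * p[of v] by auto
  ultimately show ?thesis unfolding separated_def by (meson diff_le_self)
qed

lemma finite_r_sets: "finite (r_sets n r)"
  by (rule finite_subset[of _ "Pow {0..<n}"]) (auto simp: r_sets_def)

lemma card_r_sets: "card (r_sets n r) = n choose r"
  unfolding r_sets_def using n_subsets[of "{0..<n}" r] by simp

lemma card_supersets:
  assumes "finite A" "S \<subseteq> A" "card S \<le> r"
  shows "card {h. S \<subseteq> h \<and> h \<subseteq> A \<and> card h = r} = (card A - card S) choose (r - card S)"
proof -
  let ?T = "{t. t \<subseteq> A - S \<and> card t = r - card S}"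
  have finS: "finite S" using assms finite_subset by blast
  have "{h. S \<subseteq> h \<and> h \<subseteq> A \<and> card h = r} = (\<lambda>t. S \<union> t) ` ?T"
  proof (intro equalityI subsetI)
    fix h assume "h \<in> {h. S \<subseteq> h \<and> h \<subseteq> A \<and> card h = r}"
    then have "S \<subseteq> h" "h \<subseteq> A" "card h = r" by auto
    then have "h = S \<union> (h - S)" "h - S \<in> ?T" using finS by (auto simp: card_Diff_subset)
    then show "h \<in> (\<lambda>t. S \<union> t) ` ?T" by (rule image_eqI)
  next
    fix h assume "h \<in> (\<lambda>t. S \<union> t) ` ?T"
    then obtain t where t: "h = S \<union> t" "t \<subseteq> A - S" "card t = r - card S" by auto
    have "finite t" using t(2) assms(1) finite_subset by blast
    then have "card h = card S + card t" unfolding t(1) using finS t(2) by (intro card_Un_disjoint) auto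
    then show "h \<in> {h. S \<subseteq> h \<and> h \<subseteq> A \<and> card h = r}" using t assms by auto
  qed
  moreover have "inj_on (\<lambda>t. S \<union> t) ?T" by (rule inj_onI) blast
  ultimately have "card {h. S \<subseteq> h \<and> h \<subseteq> A \<and> card h = r} = card ?T" by (simp add: card_image)
  also have "\<dots> = card (A - S) choose (r - card S)" using assms by (intro n_subsets) auto
  also have "card (A - S) = card A - card S" using assms finS by (simp add: card_Diff_subset)
  finally show ?thesis .
qed

lemma nth_image_interval: "(\<lambda>i. xs ! i) ` {0..<length xs} = set xs"
  by (auto simp: set_conv_nth)

section \<open>Copies of \<open>M1 r\<close> as separated pairs of edges\<close>

text \<open>In a copy, the cut just before the image of vertex \<open>r\<close> separates the two
  edges. Conversely, the sorted coordinates of \<open>e\<close> followed by those of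
  \<open>e'\<close> form one increasing list; read back through the inverse of
  \<open>pos n c\<close>, it is the embedding.\<close>

lemma contains_copy_M1_iff:
  assumes "r > 0" "n > 0" "H \<subseteq> r_sets n r"
  shows "contains_copy n H (2 * r) (M1 r) \<longleftrightarrow> (\<exists>e\<in>H. \<exists>e'\<in>H. separated n e e')"
proof
  assume "contains_copy n H (2 * r) (M1 r)"
  then obtain f where "cyc_order_pres (2 * r) n f"
    and H: "f ` {0..<r} \<in> H" "f ` {r..<2*r} \<in> H"
    by (auto simp: contains_copy_def M1_def)
  then obtain c where "\<forall>i j. i < j \<and> j < 2 * r \<longrightarrow> pos n c (f i) < pos n c (f j)"
    unfolding cyc_order_pres_def pos_def by meson
  then have f: "pos n c (f i) < pos n c (f j)" if "i < j" "j < 2 * r" for i j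
    using that by simp
  have "\<forall>v\<in>f ` {0..<r}. pos n c v < pos n c (f r)"
    using f assms(1) by auto
  moreover have "\<forall>v\<in>f ` {r..<2*r}. pos n c (f r) \<le> pos n c v"
    using f[of r] by (metis atLeastLessThan_iff imageE le_eq_less_or_eq order_refl)
  moreover have "pos n c (f r) \<le> n" using pos_less[OF assms(2)] less_imp_le by blast
  ultimately have "separated n (f ` {0..<r}) (f ` {r..<2*r})"
    unfolding separated_def by blast
  with H show "\<exists>e\<in>H. \<exists>e'\<in>H. separated n e e'" by blast
next
  assume "\<exists>e\<in>H. \<exists>e'\<in>H. separated n e e'"
  then obtain e e' c k where e: "e \<in> H" "e' \<in> H"
    and c: "\<forall>v\<in>e. pos n c v < k" "\<forall>v\<in>e'. k \<le> pos n c v"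
    by (auto simp: separated_def)
  note bij = pos_bij[OF assms(2), of c]
  have sub: "e \<subseteq> {0..<n}" "e' \<subseteq> {0..<n}" and card: "card e = r" "card e' = r"
    using e assms(3) by (auto simp: r_sets_def)
  have fin: "finite e" "finite e'" using sub finite_subset by blast+
  define xs where "xs = sorted_list_of_set (pos n c ` e)"
  define ys where "ys = sorted_list_of_set (pos n c ` e')"
  define g where "g = the_inv_into {0..<n} (pos n c)"
  have inj: "inj_on (pos n c) {0..<n}" using bij by (simp add: bij_betw_def)
  have len: "length xs = r" "length ys = r"
    using card sub inj fin by (auto simp: xs_def ys_def card_image inj_on_subset)
  have set: "set xs = pos n c ` e" "set ys = pos n c ` e'"
    using fin by (auto simp: xs_def ys_def)
  have sorted: "sorted_wrt (<) (xs @ ys)"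
    using c fin by (auto simp: sorted_wrt_append xs_def ys_def
        intro: strict_sorted_list_of_set less_le_trans)
  define f where "f = (\<lambda>i. g ((xs @ ys) ! i))"
  have gp: "g (pos n c v) = v" if "v < n" for v
    using that inj by (simp add: g_def the_inv_into_f_f)
  have pg: "pos n c (g v) = v" if "v < n" for v
    using that bij by (simp add: g_def f_the_inv_into_f_bij_betw)
  have im1: "f ` {0..<r} = e"
  proof -
    have "f ` {0..<r} = g ` ((\<lambda>i. xs ! i) ` {0..<length xs})"
      unfolding image_image using len by (intro image_cong) (auto simp: f_def nth_append)
    also have "\<dots> = g ` pos n c ` e" by (simp only: nth_image_interval set)
    also have "\<dots> = e" using gp sub by (force simp: image_image)
    finally show ?thesis .
  qed
  have im2: "f ` {r..<2*r} = e'"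
  proof -
    have "{r..<2*r} = (\<lambda>i. i + r) ` {0..<r}"
      by (simp add: image_add_atLeastLessThan' mult_2)
    then have "f ` {r..<2*r} = g ` ((\<lambda>i. ys ! i) ` {0..<length ys})"
      unfolding image_image using len
      by (simp only: image_image, intro image_cong) (auto simp: f_def nth_append)
    also have "\<dots> = g ` pos n c ` e'" by (simp only: nth_image_interval set)
    also have "\<dots> = e'" using gp sub by (force simp: image_image)
    finally show ?thesis .
  qed
  have lt: "(xs @ ys) ! i < n" if "i < 2 * r" for i
  proof -
    have "(xs @ ys) ! i \<in> set (xs @ ys)" using that len by (intro nth_mem) auto
    then show ?thesis using set pos_less[OF assms(2)] by auto
  qed
  have mono: "pos n c (f i) < pos n c (f j)" if "i < j" "j < 2 * r" for i j
    using that lt[of i] lt[of j] pg sorted len by (simp add: f_def sorted_wrt_iff_nth_less)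
  have "inj_on f {0..<2*r}"
    by (rule inj_onI) (metis atLeastLessThan_iff linorder_neqE_nat mono order_less_irrefl)
  moreover have "f ` {0..<2*r} \<subseteq> {0..<n}"
  proof -
    have "{0..<2*r} = {0..<r} \<union> {r..<2*r}" by auto
    then show ?thesis using im1 im2 sub by (simp add: image_Un)
  qed
  moreover have "cyc_order_pres (2*r) n f"
    using mono unfolding cyc_order_pres_def pos_def by blast
  ultimately show "contains_copy n H (2 * r) (M1 r)"
    unfolding contains_copy_def M1_def using im1 im2 e by (intro exI[of _ f]) auto
qed

lemma not_separated_self:
  assumes "e \<in> r_sets n r" "r > 0"
  shows "\<not> separated n e e"
proof -
  have "e \<noteq> {}" using assms by (auto simp: r_sets_def)
  then show ?thesis by (force simp: separated_def)
qed

section \<open>Full arcs and the sets spanning an arc\<close>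

definition full :: "nat \<Rightarrow> nat set set \<Rightarrow> nat \<Rightarrow> nat \<Rightarrow> bool" where
  "full n H c k \<longleftrightarrow> (\<exists>h\<in>H. \<forall>v\<in>h. pos n c v < k)"

definition num_full :: "nat \<Rightarrow> nat set set \<Rightarrow> nat \<Rightarrow> nat" where
  "num_full n H k = card {c. c < n \<and> full n H c k}"

definition hull_sets :: "nat \<Rightarrow> nat \<Rightarrow> nat \<Rightarrow> nat \<Rightarrow> nat set set" where
  "hull_sets n r c k =
    {e \<in> r_sets n r. pos n c ` e \<subseteq> {..<k} \<and> 0 \<in> pos n c ` e \<and> k - 1 \<in> pos n c ` e}"

text \<open>The two ends of the arc are forced and distinct, which leaves \<open>r - 2\<close>
  vertices to choose among the \<open>k - 2\<close> inner ones.\<close>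

lemma card_hull_sets:
  assumes "n > 0" "2 \<le> r" "2 \<le> k" "k \<le> n"
  shows "card (hull_sets n r c k) = (k - 2) choose (r - 2)"
proof -
  let ?Q = "\<lambda>s. card s = r \<and> s \<subseteq> {..<k} \<and> 0 \<in> s \<and> k - 1 \<in> s"
  have bij: "bij_betw (pos n c) {0..<n} {0..<n}" by (rule pos_bij[OF assms(1)])
  have "bij_betw ((`) (pos n c))
      {e \<in> Pow {0..<n}. card e = r \<and> pos n c ` e \<subseteq> {..<k} \<and> 0 \<in> pos n c ` e \<and> k - 1 \<in> pos n c ` e}
      {s \<in> Pow {0..<n}. ?Q s}"
  proof (intro bij_betw_Collect bij_betw_Pow bij)
    fix e assume "e \<in> Pow {0..<n}"
    then have "card (pos n c ` e) = card e"
      using bij by (metis Pow_iff bij_betw_def card_image inj_on_subset)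
    then show "?Q (pos n c ` e) \<longleftrightarrow>
      (card e = r \<and> pos n c ` e \<subseteq> {..<k} \<and> 0 \<in> pos n c ` e \<and> k - 1 \<in> pos n c ` e)" by simp
  qed
  then have "card (hull_sets n r c k) = card {s \<in> Pow {0..<n}. ?Q s}"
    unfolding hull_sets_def r_sets_def by (simp add: bij_betw_same_card conj_assoc)
  also have "{s \<in> Pow {0..<n}. ?Q s} = {s. {0, k - 1} \<subseteq> s \<and> s \<subseteq> {..<k} \<and> card s = r}"
    using assms by fastforce
  also have "card \<dots> = (card {..<k} - card {0, k - 1}) choose (r - card {0, k - 1})"
    by (rule card_supersets) (use assms in auto)
  also have "\<dots> = (k - 2) choose (r - 2)" using assms by (simp add: numeral_2_eq_2)
  finally show ?thesis .
qed

section \<open>Saturation as maximality among crossing families\<close>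

locale maximal_crossing =
  fixes n r :: nat and H :: "nat set set"
  assumes r2: "2 \<le> r" and n2r: "2 * r \<le> n"
    and r_sets: "H \<subseteq> r_sets n r"
    and crossing: "\<And>e e'. e \<in> H \<Longrightarrow> e' \<in> H \<Longrightarrow> \<not> separated n e e'"
    and maximal: "\<And>e. e \<in> r_sets n r \<Longrightarrow> e \<notin> H \<Longrightarrow> \<exists>h\<in>H. separated n h e"

text \<open>A copy created by adding \<open>e\<close> must pair \<open>e\<close> with an old edge:
  two old edges are never separated, and \<open>e\<close> is not separated from itself.\<close>

lemma saturated_M1_iff:
  assumes "2 \<le> r" "2 * r \<le> n"
  shows "saturated n r (2 * r) (M1 r) H \<longleftrightarrow> maximal_crossing n r H"
proof -
  have pos: "r > 0" "n > 0" using assms by auto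
  show ?thesis
  proof (cases "H \<subseteq> r_sets n r \<and> (\<forall>e\<in>H. \<forall>e'\<in>H. \<not> separated n e e')")
    case True
    have "contains_copy n (insert e H) (2*r) (M1 r) \<longleftrightarrow> (\<exists>h\<in>H. separated n h e)"
      if "e \<in> r_sets n r" for e
    proof -
      have "insert e H \<subseteq> r_sets n r" using that True by auto
      then show ?thesis
        using contains_copy_M1_iff[OF pos, of "insert e H"] True not_separated_self[OF that pos(1)]
          separated_sym[OF pos(2)] by auto
    qed
    then show ?thesis
      using True contains_copy_M1_iff[OF pos, of H] assms
      by (auto simp: saturated_def maximal_crossing_def)
  next
    case False
    then show ?thesis
      using contains_copy_M1_iff[OF pos, of H]
      by (auto simp: saturated_def maximal_crossing_def)
  qed
qed

section \<open>An arc and its complement\<close>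

context maximal_crossing
begin

lemma n_pos: "n > 0" using r2 n2r by linarith

lemma full_disjoint:
  assumes "full n H c k" "full n H c' k'"
  shows "\<exists>v<n. pos n c v < k \<and> pos n c' v < k'"
proof (rule ccontr)
  assume contr: "\<not> ?thesis"
  from assms obtain h h' where h: "h \<in> H" "\<forall>v\<in>h. pos n c v < k" "h' \<in> H" "\<forall>v\<in>h'. pos n c' v < k'"
    by (auto simp: full_def)
  have "h \<subseteq> {0..<n}" "h' \<subseteq> {0..<n}" using h r_sets by (auto simp: r_sets_def)
  then have "k \<le> pos n c v" if "v \<in> h'" for v
    using contr h(4) that by (meson atLeastLessThan_iff not_le subsetD)
  \<comment> \<open>The cut is at \<open>min k n\<close> because \<open>separated\<close> asks for a
    length of at most \<open>n\<close>, while \<open>k\<close> is arbitrary here.\<close>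
  then have "\<forall>v\<in>h. pos n c v < min k n" "\<forall>v\<in>h'. min k n \<le> pos n c v"
    using h pos_less[OF n_pos, of c] by (auto simp: min_le_iff_disj)
  then have "separated n h h'" unfolding separated_def by (meson min.cobounded2)
  with h crossing show False by blast
qed

lemma full_mono:
  assumes "full n H c k" "\<And>v. v < n \<Longrightarrow> pos n c v < k \<Longrightarrow> pos n c' v < k'"
  shows "full n H c' k'"
proof -
  from assms(1) obtain h where h: "h \<in> H" "\<forall>v\<in>h. pos n c v < k" by (auto simp: full_def)
  then have "h \<subseteq> {0..<n}" using r_sets by (auto simp: r_sets_def)
  then have "\<forall>v\<in>h. pos n c' v < k'" using h(2) assms(2) by (simp add: subset_iff)
  then show ?thesis using h(1) unfolding full_def by blast
qed

lemma not_full_small: assumes "k < r" shows "\<not> full n H c k"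
proof
  assume "full n H c k"
  then obtain h where h: "h \<in> H" "pos n c ` h \<subseteq> {..<k}" by (auto simp: full_def)
  have "h \<subseteq> {0..<n}" "card h = r" using h r_sets by (auto simp: r_sets_def)
  then have "card (pos n c ` h) = r"
    using pos_bij[OF n_pos, of c] by (auto simp: bij_betw_def intro: card_image inj_on_subset)
  with card_mono[OF _ h(2)] assms show False by simp
qed

lemma full_mod: "full n H (c mod n) k \<longleftrightarrow> full n H c k"
  by (simp add: full_def pos_mod)

text \<open>A test set \<open>e\<close> with \<open>r - 1\<close> vertices at the beginning of the
  arc and one at its end is no edge, so some edge \<open>h\<close> is separated from it. The arc
  around \<open>h\<close> avoids both ends of the given arc, hence lies in that arc or in its
  complement and makes it full.\<close>

lemma full_or_complement_full_aux:
  assumes k: "r \<le> k" "k \<le> n" and "\<not> full n H c k" "\<not> full n H (c + (n - k)) (n - k)"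
  shows False
proof -
  have "insert (k - 1) {..<r - 1} \<subseteq> {..<n}" using k r2 by auto
  then obtain e where e: "e \<subseteq> {0..<n}" "pos n c ` e = insert (k - 1) {..<r - 1}"
    "card e = card (insert (k - 1) {..<r - 1})" using ex_preimage[OF n_pos] by metis
  have "card e = r" using e(3) k r2 by simp
  then have er: "e \<in> r_sets n r" using e by (simp add: r_sets_def)
  have "e \<notin> H"
  proof
    assume "e \<in> H"
    moreover have "pos n c v < k" if "v \<in> e" for v
    proof -
      have "pos n c v \<in> insert (k - 1) {..<r - 1}" using e(2) that by blast
      then show ?thesis using k r2 by auto
    qed
    ultimately show False using assms(3) by (auto simp: full_def)
  qed
  from maximal[OF er this] obtain h c' l where h: "h \<in> H" "l \<le> n" "\<forall>v\<in>h. pos n c' v < l" "\<forall>v\<in>e. l \<le> pos n c' v"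
    by (auto simp: separated_def)
  have fl: "full n H c' l" using h by (auto simp: full_def)
  obtain d where d: "d < n" "\<And>v. pos n c' v = pos n (c + d) v" using shift_exists[OF n_pos, of c' c] by metis
  have pd: "pos n c' v = (if pos n c v + d < n then pos n c v + d else pos n c v + d - n)" for v
    using pos_add_if[OF n_pos, of d c v] d by simp
  obtain v0 v1 where v: "v0 \<in> e" "pos n c v0 = 0" "v1 \<in> e" "pos n c v1 = k - 1"
  proof -
    have "0 \<in> pos n c ` e" "k - 1 \<in> pos n c ` e" using e(2) r2 by auto
    then show ?thesis using that by (metis imageE)
  qed
  \<comment> \<open>In the coordinates of \<open>c\<close>, the arc around \<open>h\<close> begins
    at \<open>n - d\<close>; \<open>l \<le> d\<close> says that it stops before reaching coordinate
    0 again.\<close>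
  have ld: "l \<le> d" using h(4) v(1,2) pd[of v0] d by auto
  have "l \<le> pos n c' v1" using h(4) v by blast
  \<comment> \<open>The last vertex of the given arc comes either before or after the arc around
    \<open>h\<close>.\<close>
  then have "k - 1 < n - d \<or> k - 1 \<ge> n - d + l" using pd[of v1] v(4) d(1) by (auto split: if_splits)
  then show False
  proof
    assume a: "k - 1 < n - d"
    have "full n H (c + (n - k)) (n - k)"
    proof (rule full_mono[OF fl])
      fix v assume "v < n" "pos n c' v < l"
      then show "pos n (c + (n - k)) v < n - k"
        using pd[of v] ld a d(1) pos_complement[OF n_pos k(2), of c v] pos_less[OF n_pos, of c v] by (auto split: if_splits)
    qed
    with assms show False by simp
  next
    assume a: "k - 1 \<ge> n - d + l"
    have "full n H c k"
    proof (rule full_mono[OF fl])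
      fix v assume "v < n" "pos n c' v < l"
      then show "pos n c v < k"
        using pd[of v] ld a d(1) by (auto split: if_splits)
    qed
    with assms show False by simp
  qed
qed

lemma pos_complement2:
  assumes "k \<le> n"
  shows "pos n (c + (n - k) + (n - (n - k))) v = pos n c v"
proof -
  have "c + (n - k) + (n - (n - k)) = c + n" using assms by simp
  then show ?thesis by (simp add: pos_def flip: add.assoc)
qed

text \<open>Disjoint arcs are not both full. That one of them is full follows from the auxiliary
  lemma for the arc itself if \<open>r \<le> k\<close>, and otherwise for the complement, which has
  at least \<open>r\<close> vertices by \<open>2 * r \<le> n\<close>.\<close>

lemma full_complement:
  assumes "k \<le> n"
  shows "full n H (c + (n - k)) (n - k) \<longleftrightarrow> \<not> full n H c k"
proof -
  have "\<not> (full n H c k \<and> full n H (c + (n - k)) (n - k))"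
    using full_disjoint[of c k "c + (n - k)" "n - k"] pos_complement[OF n_pos assms, of c] by (auto split: if_splits)
  moreover have "full n H c k \<or> full n H (c + (n - k)) (n - k)"
  proof (cases "r \<le> k")
    case True
    then show ?thesis using full_or_complement_full_aux[OF _ assms] by blast
  next
    case False
    have "r \<le> n - k" using False n2r by linarith
    moreover have "full n H (c + (n - k) + (n - (n - k))) (n - (n - k)) \<longleftrightarrow> full n H c k"
      using pos_complement2[OF assms] assms by (simp add: full_def)
    ultimately show ?thesis
      using full_or_complement_full_aux[of "n - k" "c + (n - k)"] by (meson diff_le_self)
  qed
  ultimately show ?thesis by blast
qed

lemma num_full_complement:
  assumes "k \<le> n"
  shows "card {c. c < n \<and> \<not> full n H c k} = num_full n H (n - k)"
proof -
  \<comment> \<open>Here \<open>pos\<close> acts on the parameters \<open>c\<close> of arcs: the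
    shift by \<open>n - k\<close> sends each arc of length \<open>k\<close> to its
    complement.\<close>
  have "bij_betw (pos n (n - k)) {0..<n} {0..<n}" by (rule pos_bij[OF n_pos])
  moreover have "full n H (pos n (n - k) c) (n - k) \<longleftrightarrow> \<not> full n H c k" for c
    using full_complement[OF assms, of c] by (simp add: pos_def full_mod)
  ultimately have "bij_betw (pos n (n - k)) {c \<in> {0..<n}. \<not> full n H c k} {c \<in> {0..<n}. full n H c (n - k)}"
    by (intro bij_betw_Collect) auto
  then have "bij_betw (pos n (n - k)) {c. c < n \<and> \<not> full n H c k} {c. c < n \<and> full n H c (n - k)}"
    by (simp add: atLeast0LessThan)
  then show ?thesis unfolding num_full_def by (rule bij_betw_same_card)
qed

lemma num_full_add:
  assumes "k \<le> n"
  shows "num_full n H k + num_full n H (n - k) = n"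
proof -
  have "card ({c. c < n \<and> full n H c k} \<union> {c. c < n \<and> \<not> full n H c k})
      = num_full n H k + card {c. c < n \<and> \<not> full n H c k}"
    unfolding num_full_def by (intro card_Un_disjoint) auto
  moreover have "{c. c < n \<and> full n H c k} \<union> {c. c < n \<and> \<not> full n H c k} = {..<n}" by auto
  ultimately show ?thesis using num_full_complement[OF assms] by simp
qed

lemma num_full_small: "k < r \<Longrightarrow> num_full n H k = 0"
  using not_full_small by (simp add: num_full_def)

section \<open>Counting non-edges by their hulls\<close>

text \<open>A non-edge is separated from an edge; the arc of that edge is full, so the complementary
  arc, which contains the non-edge, is not. Conversely, an edge makes every arc around it
  full.\<close>

lemma nonedge_in_nonfull:
  assumes "e \<in> r_sets n r"
  shows "e \<notin> H \<longleftrightarrow> (\<exists>c k. k \<le> n \<and> \<not> full n H c k \<and> (\<forall>v\<in>e. pos n c v < k))"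
proof
  assume "e \<notin> H"
  from maximal[OF assms this] obtain h c k where h: "h \<in> H" "k \<le> n" "\<forall>v\<in>h. pos n c v < k"
    "\<forall>v\<in>e. k \<le> pos n c v"
    by (auto simp: separated_def)
  have "full n H c k" using h by (auto simp: full_def)
  then have "\<not> full n H (c + (n - k)) (n - k)" using full_complement h by blast
  moreover have "pos n (c + (n - k)) v < n - k" if "v \<in> e" for v
    using that h(4) pos_complement[OF n_pos h(2), of c v] pos_less[OF n_pos, of c v] by auto
  ultimately show "\<exists>c k. k \<le> n \<and> \<not> full n H c k \<and> (\<forall>v\<in>e. pos n c v < k)"
    by (meson diff_le_self)
qed (auto simp: full_def)

text \<open>A non-full arc around \<open>e\<close> is cut down to the stretch between the first and
  the last vertex of \<open>e\<close>; a subarc of a non-full arc is not full.\<close>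

lemma nonedge_hull:
  assumes e: "e \<in> r_sets n r" "e \<notin> H"
  shows "\<exists>c k. c < n \<and> 2 \<le> k \<and> k \<le> n - 2 \<and> \<not> full n H c k \<and> e \<in> hull_sets n r c k"
proof -
  obtain c k where ck: "k \<le> n" "\<not> full n H c k" "\<forall>v\<in>e. pos n c v < k"
    using nonedge_in_nonfull[OF e(1)] e(2) by blast
  define P where "P = pos n c ` e"
  have sub: "e \<subseteq> {0..<n}" and "card e = r" using e by (auto simp: r_sets_def)
  have "finite e" using sub finite_subset by blast
  have cardP: "card P = r" unfolding P_def
    using \<open>card e = r\<close> sub pos_bij[OF n_pos, of c] by (metis bij_betw_def card_image inj_on_subset)
  have P: "finite P" "P \<noteq> {}" using \<open>finite e\<close> cardP r2 by (auto simp: P_def)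
  define a where "a = Min P"
  define b where "b = Max P"
  have ab: "a \<in> P" "b \<in> P" "\<And>p. p \<in> P \<Longrightarrow> a \<le> p \<and> p \<le> b"
    using P by (auto simp: a_def b_def)
  have bk: "b < k" using ab(2) ck(3) by (auto simp: P_def)
  have lt: "a < b"
  proof (rule ccontr)
    assume "\<not> a < b"
    then have "P \<subseteq> {a}" using ab by force
    then have "card P \<le> 1" using card_mono[of "{a}" P] by simp
    with cardP r2 show False by simp
  qed
  define c' where "c' = (c + (n - a)) mod n"
  define k' where "k' = b - a + 1"
  have pc: "pos n c' v = (if pos n c v < a then pos n c v + n - a else pos n c v - a)" for v
    unfolding c'_def pos_mod by (rule pos_complement[OF n_pos]) (use bk ck lt in linarith)
  have nf: "\<not> full n H c' k'"
  proof
    assume "full n H c' k'"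
    then have "full n H c k"
      by (rule full_mono) (use pc bk lt in \<open>auto simp: k'_def split: if_splits\<close>)
    with ck show False by simp
  qed
  have "k' \<le> n" using bk ck lt by (simp add: k'_def)
  \<comment> \<open>A longer arc leaves at most one vertex outside, too few for an edge, and would
    therefore be full.\<close>
  have "k' \<le> n - 2"
  proof (rule ccontr)
    assume "\<not> k' \<le> n - 2"
    then have "n - k' < r" using r2 by linarith
    then show False using not_full_small full_complement[OF \<open>k' \<le> n\<close>] nf by blast
  qed
  moreover have "e \<in> hull_sets n r c' k'"
  proof -
    have "pos n c' v = pos n c v - a" if "v \<in> e" for v
      using ab(3)[of "pos n c v"] pc[of v] that by (auto simp: P_def)
    then have im: "pos n c' ` e = (\<lambda>p. p - a) ` P"
      unfolding P_def image_image by (rule image_cong[OF refl])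
    have "0 \<in> pos n c' ` e" "k' - 1 \<in> pos n c' ` e"
      unfolding im k'_def using ab(1,2) by (auto intro: image_eqI[of _ _ a] image_eqI[of _ _ b])
    moreover have "pos n c' ` e \<subseteq> {..<k'}"
      unfolding im k'_def using ab(3) lt by (auto simp: less_Suc_eq_le diff_le_mono)
    ultimately show ?thesis using e(1) by (simp add: hull_sets_def)
  qed
  moreover have "c' < n" using n_pos by (simp add: c'_def)
  moreover have "2 \<le> k'" using lt by (simp add: k'_def)
  ultimately show ?thesis using nf by blast
qed

text \<open>If two arcs with end vertices in \<open>e\<close> both contain \<open>e\<close> and start at different vertices,
  each of them covers the complement of the other.\<close>

lemma nonnonedge_hull_unique:
  assumes "e \<in> hull_sets n r c k" "e \<in> hull_sets n r c' l" "c < n" "c' < n"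
    and k: "0 < k" "k \<le> n" "0 < l"
    and nf: "\<not> full n H c k" "\<not> full n H c' l"
  shows "c = c' \<and> k = l"
proof -
  obtain d where d: "d < n" "\<And>v. pos n c' v = pos n (c + d) v" "c' mod n = (c + d) mod n"
    using shift_exists[OF n_pos, of c' c] by metis
  have pd: "pos n c' v = (if pos n c v + d < n then pos n c v + d else pos n c v + d - n)" for v
    using pos_add_if[OF n_pos, of d c v] d by simp
  from assms(1,2) have all: "\<And>v. v \<in> e \<Longrightarrow> pos n c v < k \<and> pos n c' v < l"
    by (auto simp: hull_sets_def)
  from assms(1) obtain v0 v1 where v: "v0 \<in> e" "pos n c v0 = 0" "v1 \<in> e" "pos n c v1 = k - 1"
    unfolding hull_sets_def by (smt (verit) imageE mem_Collect_eq)
  from assms(2) obtain u0 u1 where u: "u0 \<in> e" "pos n c' u0 = 0" "u1 \<in> e" "pos n c' u1 = l - 1"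
    unfolding hull_sets_def by (smt (verit) imageE mem_Collect_eq)
  show ?thesis
  proof (cases "d = 0")
    case True
    then have "c = c'" using d(3) assms(3,4) by simp
    moreover have "k - 1 < l" "l - 1 < k" using all[OF v(3)] all[OF u(3)] v u \<open>c = c'\<close> by auto
    ultimately show ?thesis using k by linarith
  next
    case False
    \<comment> \<open>\<open>d < l\<close> and \<open>n - d < k\<close> say that each arc contains
      the start of the other, so together they go around the circle.\<close>
    have "d < l" using all[OF v(1)] pd[of v0] v(2) d(1) by simp
    have "pos n c u0 = n - d"
      using pd[of u0] u(2) False pos_less[OF n_pos, of c u0] by (auto split: if_splits)
    then have "n - d < k" using all[OF u(1)] by simp
    have "full n H (c + (n - k)) (n - k)" using full_complement[OF k(2)] nf by blast
    then have "full n H c' l"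
    proof (rule full_mono)
      fix v assume "v < n" "pos n (c + (n - k)) v < n - k"
      then have "k \<le> pos n c v"
        using pos_complement[OF n_pos k(2), of c v] by (auto split: if_splits)
      then show "pos n c' v < l"
        using pd[of v] \<open>n - d < k\<close> \<open>d < l\<close> pos_less[OF n_pos, of c v] by auto
    qed
    with nf show ?thesis by simp
  qed
qed

text \<open>The families \<open>hull_sets\<close> over the non-full arcs partition the non-edges, by
  \<open>nonedge_hull\<close> and \<open>nonnonedge_hull_unique\<close>. The factor
  \<open>num_full n H (n - k)\<close> counts the non-full arcs of length \<open>k\<close> through
  their complements.\<close>

lemma card_nonedges:
  "card (r_sets n r - H) = (\<Sum>k=2..n-2. num_full n H (n - k) * ((k - 2) choose (r - 2)))"
proof -
  define I where "I = (SIGMA k:{2..n-2}. {c. c < n \<and> \<not> full n H c k})"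
  have finI: "finite I" by (auto simp: I_def)
  have "r_sets n r - H = (\<Union>(k, c)\<in>I. hull_sets n r c k)"
  proof (intro equalityI subsetI)
    fix e assume "e \<in> r_sets n r - H"
    with nonedge_hull[of e] show "e \<in> (\<Union>(k, c)\<in>I. hull_sets n r c k)"
      unfolding I_def by force
  next
    fix e assume "e \<in> (\<Union>(k, c)\<in>I. hull_sets n r c k)"
    then obtain c k where e: "e \<in> hull_sets n r c k" "\<not> full n H c k" by (auto simp: I_def)
    then have "\<forall>v\<in>e. pos n c v < k" by (auto simp: hull_sets_def)
    with e(2) have "e \<notin> H" unfolding full_def by blast
    with e show "e \<in> r_sets n r - H" by (simp add: hull_sets_def)
  qed
  also have "card \<dots> = (\<Sum>(k, c)\<in>I. card (hull_sets n r c k))"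
  proof (subst card_UN_disjoint[OF finI])
    show "\<forall>i\<in>I. finite (case i of (k, c) \<Rightarrow> hull_sets n r c k)"
      using finite_r_sets[of n r] by (auto simp: hull_sets_def)
    show "\<forall>i\<in>I. \<forall>j\<in>I. i \<noteq> j \<longrightarrow> (case i of (k, c) \<Rightarrow> hull_sets n r c k) \<inter> (case j of (k, c) \<Rightarrow> hull_sets n r c k) = {}"
    proof (clarsimp simp: I_def, rule ccontr)
      fix k c l c' assume *: "2 \<le> k" "k \<le> n - 2" "c < n" "\<not> full n H c k" "2 \<le> l" "l \<le> n - 2" "c' < n"
        "\<not> full n H c' l" "k = l \<longrightarrow> c \<noteq> c'" "hull_sets n r c k \<inter> hull_sets n r c' l \<noteq> {}"
      then obtain e where "e \<in> hull_sets n r c k" "e \<in> hull_sets n r c' l" by blast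
      from nonnonedge_hull_unique[OF this] * show False by auto
    qed
  qed (auto intro!: sum.cong)
  also have "\<dots> = (\<Sum>(k, c)\<in>I. (k - 2) choose (r - 2))"
    by (rule sum.cong) (auto simp: I_def card_hull_sets[OF n_pos r2])
  also have "\<dots> = (\<Sum>k=2..n-2. \<Sum>c\<in>{c. c < n \<and> \<not> full n H c k}. (k - 2) choose (r - 2))"
    unfolding I_def by (subst sum.Sigma) auto
  also have "\<dots> = (\<Sum>k=2..n-2. num_full n H (n - k) * ((k - 2) choose (r - 2)))"
    by (rule sum.cong) (auto simp: num_full_complement)
  finally show ?thesis .
qed

section \<open>How many arcs of one length can be full\<close>

text \<open>Shifting an arc of length \<open>k\<close> by \<open>d\<close> with
  \<open>k \<le> d \<le> n - k\<close> makes it disjoint from itself.\<close>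

lemma full_shift:
  assumes "full n H c k" "full n H (c + d) k" "d \<le> n"
  shows "d < k \<or> n - k < d"
proof (rule ccontr)
  assume "\<not> ?thesis"
  then have d: "k \<le> d" "d \<le> n - k" by auto
  obtain v where "pos n c v < k" "pos n (c + d) v < k"
    using full_disjoint[OF assms(1,2)] by blast
  with d pos_add_if[OF n_pos assms(3), of c v] show False by (auto split: if_splits)
qed

text \<open>Katona's cycle argument: relative to a fixed full arc \<open>c\<^sub>0\<close>, every other full arc of length
  \<open>k\<close> starts less than \<open>k\<close> steps away, and of the starts \<open>c\<^sub>0 + j\<close> and \<open>c\<^sub>0 + j - k\<close> at most one occurs.\<close>

lemma num_full_le:
  assumes "2 * k \<le> n"
  shows "num_full n H k \<le> k"
proof (cases "{c. c < n \<and> full n H c k} = {}")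
  case True
  then show ?thesis unfolding num_full_def by (metis card.empty le0)
next
  case False
  then obtain c0 where c0: "full n H c0 k" by blast
  define D where "D = {d. d < n \<and> full n H (c0 + d) k}"
  have "bij_betw (pos n c0) {d \<in> {0..<n}. full n H (c0 + d) k} {c \<in> {0..<n}. full n H c k}"
    by (intro bij_betw_Collect pos_bij n_pos) (simp add: pos_def full_mod add.commute)
  then have "num_full n H k = card D"
    unfolding num_full_def D_def by (simp add: atLeast0LessThan bij_betw_same_card)
  also have "\<dots> \<le> card {..<k}"
  proof (rule card_inj_on_le)
    \<comment> \<open>The two offsets \<open>j\<close> and \<open>j + (n - k)\<close>, which exclude
      each other, receive the same value, so injectivity on \<open>D\<close> amounts to this
      exclusion.\<close>
    let ?f = "\<lambda>d. if d < k then d else d - (n - k)"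
    have D: "d < k \<or> n - k < d" if "d \<in> D" for d
      using that full_shift[OF c0, of d] by (simp add: D_def)
    show "?f ` D \<subseteq> {..<k}"
    proof (rule image_subsetI)
      fix d assume "d \<in> D"
      then show "?f d \<in> {..<k}" using D[of d] assms by (auto simp: D_def)
    qed
    have apart: "\<not> (j \<in> D \<and> j + (n - k) \<in> D)" if "j < k" for j
      using full_shift[of "c0 + j" k "n - k"] assms that by (auto simp: D_def add.assoc)
    show "inj_on ?f D"
    proof (rule inj_onI)
      fix x y assume xy: "x \<in> D" "y \<in> D" "?f x = ?f y"
      have mixed: False if "u \<in> D" "v \<in> D" "u < k" "\<not> v < k" "u = v - (n - k)" for u v
      proof -
        have "v = u + (n - k)" using D[OF that(2)] that by simp
        then show False using apart[of u] that by blast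
      qed
      consider "x < k" "y < k" | "x < k" "\<not> y < k" | "\<not> x < k" "y < k" | "\<not> x < k" "\<not> y < k"
        by blast
      then show "x = y"
      proof cases
        case 1
        then show ?thesis using xy(3) by simp
      next
        case 2
        then have "x = y - (n - k)" using xy(3) by simp
        with 2 show ?thesis using mixed[OF xy(1,2)] by blast
      next
        case 3
        then have "y = x - (n - k)" using xy(3) by simp
        with 3 show ?thesis using mixed[OF xy(2,1)] by blast
      next
        case 4
        then show ?thesis using D[OF xy(1)] D[OF xy(2)] xy(3) by simp
      qed
    qed
  qed simp
  finally show ?thesis by simp
qed

text \<open>Relative to one full arc, the others have offsets -2, -1, 1 or 2, and at least two of
  these occur. Offsets whose arcs are disjoint exclude each other, which leaves only {1, 2}, {-1, 1}
  and {-2, -1}.\<close>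

lemma three_consecutive_full:
  assumes "6 < n" "3 \<le> num_full n H 3"
  shows "\<exists>c. full n H c 3 \<and> full n H (c + 1) 3 \<and> full n H (c + 2) 3"
proof -
  define S where "S = {c. c < n \<and> full n H c 3}"
  have cS: "3 \<le> card S" using assms(2) by (simp only: num_full_def S_def)
  then have "S \<noteq> {}" by auto
  then obtain c where c: "c \<in> S" by blast
  then have fc: "full n H c 3" by (simp add: S_def)
  have period: "full n H (d + n) 3 \<longleftrightarrow> full n H d 3" for d
    using full_mod[of "d + n" 3] full_mod[of d 3] by simp
  let ?F = "\<lambda>d. full n H (c + d) 3"
  have near: "x \<in> (\<lambda>d. (c + d) mod n) ` ({0} \<union> {d \<in> {1, 2, n - 2, n - 1}. ?F d})" if x: "x \<in> S" for x
  proof -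
    obtain d where d: "d < n" "x mod n = (c + d) mod n" using shift_exists[OF n_pos, of x c] by metis
    have "full n H x 3" "x < n" using x by (auto simp: S_def)
    then have "?F d" "x = (c + d) mod n" using d full_mod[of x 3] full_mod[of "c + d" 3] by auto
    moreover have "d \<in> {0, 1, 2, n - 2, n - 1}" using full_shift[OF fc \<open>?F d\<close>] d(1) by auto
    ultimately show ?thesis by blast
  qed
  have not_both: "\<not> (?F i \<and> ?F j)" if "i + 3 \<le> j" "j + 3 \<le> i + n" for i j
  proof -
    have "3 \<le> j - i" "j - i \<le> n - 3" "j - i \<le> n" "c + i + (j - i) = c + j"
      using that assms(1) by linarith+
    then show ?thesis using full_shift[of "c + i" 3 "j - i"] by auto
  qed
  \<comment> \<open>A single further offset \<open>d\<close> would account for at most two full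
    arcs.\<close>
  have two: "\<not> {d \<in> {1, 2, n - 2, n - 1}. ?F d} \<subseteq> {d}" for d
  proof
    assume "{d \<in> {1, 2, n - 2, n - 1}. ?F d} \<subseteq> {d}"
    then have "S \<subseteq> (\<lambda>d. (c + d) mod n) ` {0, d}" using near by blast
    then have "card S \<le> card ((\<lambda>d. (c + d) mod n) ` {0, d})" by (intro card_mono) auto
    also have "\<dots> \<le> card {0, d}" by (rule card_image_le) simp
    also have "\<dots> \<le> 2" by (simp add: card_insert_if)
    finally show False using cS by simp
  qed
  have "?F 2 \<or> ?F (n - 2) \<or> ?F (n - 1)" using two[of 1] by blast
  moreover have "?F 1 \<or> ?F (n - 2) \<or> ?F (n - 1)" using two[of 2] by blast
  moreover have "?F 1 \<or> ?F 2 \<or> ?F (n - 1)" using two[of "n - 2"] by blast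
  moreover have "?F 1 \<or> ?F 2 \<or> ?F (n - 2)" using two[of "n - 1"] by blast
  \<comment> \<open>The offsets \<open>2\<close> and \<open>n - 2\<close> need \<open>6 < n\<close>:
    for \<open>n = 6\<close> these two arcs still meet.\<close>
  moreover have "\<not> (?F 1 \<and> ?F (n - 2))" "\<not> (?F 2 \<and> ?F (n - 1))" "\<not> (?F 2 \<and> ?F (n - 2))"
    by (rule not_both; use assms(1) in linarith)+
  ultimately have "?F 1 \<and> ?F 2 \<or> ?F 1 \<and> ?F (n - 1) \<or> ?F (n - 2) \<and> ?F (n - 1)" by argo
  then show ?thesis
  proof (elim disjE conjE)
    assume "?F 1" "?F 2"
    then show ?thesis using fc by blast
  next
    assume "?F 1" "?F (n - 1)"
    moreover have "c + (n - 1) + 1 = c + n" "c + (n - 1) + 2 = c + 1 + n" using assms(1) by auto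
    ultimately show ?thesis using fc period by metis
  next
    assume "?F (n - 2)" "?F (n - 1)"
    moreover have "c + (n - 2) + 1 = c + (n - 1)" "c + (n - 2) + 2 = c + n" using assms(1) by auto
    ultimately show ?thesis using fc period by metis
  qed
qed

lemma edge_meets_full:
  assumes "full n H c k" "k \<le> n" "e \<in> H"
  shows "\<exists>v\<in>e. pos n c v < k"
proof (rule ccontr)
  assume "\<not> ?thesis"
  moreover obtain h where "h \<in> H" "\<forall>v\<in>h. pos n c v < k" using assms(1) by (auto simp: full_def)
  ultimately have "separated n h e" using assms(2) unfolding separated_def by (meson not_le)
  with crossing \<open>h \<in> H\<close> assms(3) show False by blast
qed

section \<open>Comparing the sizes of two saturated families\<close>

text \<open>Adding the sum to its reflection under \<open>n - k\<close> brings the counts for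
  \<open>k\<close> and \<open>n - k\<close>, whose total is \<open>n\<close>, into one term.
  Doubling avoids a special middle term \<open>2 * k = n\<close>.\<close>

lemma twice_card_nonedges:
  "2 * card (r_sets n r - H) =
    (\<Sum>k=2..n-2. num_full n H (n - k) * ((k - 2) choose (r - 2))
                + num_full n H k * ((n - k - 2) choose (r - 2)))"
proof -
  have flip: "(\<Sum>k=2..n-2. g k) = (\<Sum>k=2..n-2. g (n - k))" for g :: "nat \<Rightarrow> nat"
    using n2r r2 by (intro sum.reindex_bij_witness[of _ "\<lambda>k. n - k" "\<lambda>k. n - k"]) auto
  have "(\<Sum>k=2..n-2. num_full n H (n - k) * ((k - 2) choose (r - 2)))
      = (\<Sum>k=2..n-2. num_full n H (n - (n - k)) * ((n - k - 2) choose (r - 2)))"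
    by (rule flip)
  also have "\<dots> = (\<Sum>k=2..n-2. num_full n H k * ((n - k - 2) choose (r - 2)))"
    by (rule sum.cong) auto
  finally show ?thesis using card_nonedges by (simp add: sum.distrib)
qed

lemma card_edges: "card H = (n choose r) - card (r_sets n r - H)"
  "card (r_sets n r - H) \<le> n choose r"
  using card_Diff_subset[OF finite_subset[OF r_sets finite_r_sets] r_sets] card_mono[OF finite_r_sets r_sets]
  by (auto simp: card_r_sets)

end

text \<open>With a fixed total, moving \<open>a' - a\<close> units from the weight \<open>w\<close>
  to the larger weight \<open>w'\<close> cannot decrease the weighted sum.\<close>

lemma exchange_le:
  fixes a a' b b' w w' :: nat
  assumes "a \<le> a'" "a + b = a' + b'" "w \<le> w'"
  shows "b * w + a * w' \<le> b' * w + a' * w'"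
proof -
  obtain d where d: "a' = a + d" using assms(1) le_Suc_ex by blast
  then have "b = b' + d" using assms(2) by simp
  then show ?thesis using d assms(3) by (simp add: algebra_simps)
qed

lemma exchange_less:
  fixes a a' b b' w w' :: nat
  assumes "a < a'" "a + b = a' + b'" "w < w'"
  shows "b * w + a * w' < b' * w + a' * w'"
proof -
  obtain d where d: "a' = a + d" "d > 0" using assms(1) less_imp_add_positive by blast
  then have "b = b' + d" using assms(2) by simp
  then show ?thesis using d assms(3) by (simp add: algebra_simps)
qed

text \<open>For \<open>2 * k \<le> n\<close> the count of full arcs of length \<open>k\<close>
  carries the larger weight \<open>?w (n - k)\<close>, so more short full arcs mean more non-edges.
  At \<open>k = r\<close> the two weights differ if \<open>3 \<le> r\<close> and
  \<open>2 * r < n\<close>, which gives strictness.\<close>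

lemma card_comparison:
  assumes "maximal_crossing n r H" "maximal_crossing n r H'"
    and le: "\<And>k. r \<le> k \<Longrightarrow> 2 * k \<le> n \<Longrightarrow> num_full n H k \<le> num_full n H' k"
  shows "card H' \<le> card H"
    and "3 \<le> r \<Longrightarrow> 2 * r < n \<Longrightarrow> num_full n H r < num_full n H' r \<Longrightarrow> card H' < card H"
proof -
  interpret A: maximal_crossing n r H by fact
  interpret B: maximal_crossing n r H' by fact
  let ?w = "\<lambda>k. (k - 2) choose (r - 2)"
  let ?T = "\<lambda>H k. num_full n H (n - k) * ?w k + num_full n H k * ?w (n - k)"
  have sum_eq: "num_full n H k + num_full n H (n - k) = num_full n H' k + num_full n H' (n - k)"
    if "k \<le> n" for k using A.num_full_add[OF that] B.num_full_add[OF that] by simp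
  have half: "?T H k \<le> ?T H' k" if "2 * k \<le> n" for k
  proof (rule exchange_le)
    show "num_full n H k \<le> num_full n H' k"
      using le[of k] that A.num_full_small[of k] by (cases "r \<le> k") auto
    show "?w k \<le> ?w (n - k)" using that by (intro binomial_right_mono) auto
  qed (use sum_eq that in simp)
  \<comment> \<open>For \<open>2 * k > n\<close> the term is that of \<open>n - k\<close> with its
    summands exchanged.\<close>
  have T: "?T H k \<le> ?T H' k" if "k \<in> {2..n-2}" for k
  proof (cases "2 * k \<le> n")
    case False
    have "k \<le> n" using that by auto
    then have kk: "n - (n - k) = k" by simp
    have "2 * (n - k) \<le> n" using False by simp
    from half[OF this] show ?thesis unfolding kk by (simp only: add.commute)
  qed (use half in simp)
  have "2 * card (r_sets n r - H) \<le> 2 * card (r_sets n r - H')"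
    unfolding A.twice_card_nonedges B.twice_card_nonedges by (intro sum_mono T)
  then show "card H' \<le> card H" using A.card_edges B.card_edges by simp
  assume r: "3 \<le> r" "2 * r < n" and less: "num_full n H r < num_full n H' r"
  have "?T H r < ?T H' r"
  proof (rule exchange_less[OF less])
    \<comment> \<open>By Pascal's rule the increment is positive because \<open>r - 2 > 0\<close>;
      for \<open>r = 2\<close> all weights would be 1.\<close>
    have "?w r < ?w (r + 1)"
    proof -
      have "r + 1 - 2 = Suc (r - 2)" "r - 2 > 0" using r by auto
      then show ?thesis by (simp add: binomial_Suc_n)
    qed
    also have "\<dots> \<le> ?w (n - r)" using r by (intro binomial_right_mono) auto
    finally show "?w r < ?w (n - r)" .
  qed (use sum_eq r in simp)
  moreover have "r \<in> {2..n-2}" using r by auto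
  ultimately have "\<exists>k\<in>{2..n-2}. ?T H k < ?T H' k" by (rule rev_bexI[rotated])
  then have "2 * card (r_sets n r - H) < 2 * card (r_sets n r - H')"
    unfolding A.twice_card_nonedges B.twice_card_nonedges
    by (intro sum_strict_mono_ex1 ballI T finite_atLeastAtMost)
  then show "card H' < card H" using A.card_edges B.card_edges by simp
qed

section \<open>\<open>Hnr n r\<close> is saturated and has the fewest edges\<close>

lemma Hnr_subset: "Hnr n r \<subseteq> r_sets n r"
  by (auto simp: Hnr_def)

lemma Hnr_contains_0: "h \<in> r_sets n r \<Longrightarrow> 0 \<in> h \<Longrightarrow> h \<in> Hnr n r"
  by (simp add: Hnr_def)

text \<open>An edge \<open>h'\<close> outside an arc through 0 lacks 0, so it contains some
  \<open>j\<close> and \<open>m\<close> with at most \<open>r - 1\<close> vertices strictly between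
  \<open>m\<close> and \<open>j\<close> on the side of 0. The arc lies in this gap and has no room
  for the \<open>r\<close>-set \<open>h\<close>.\<close>

lemma Hnr_no_split:
  assumes n: "n > 0" and h: "h \<in> r_sets n r" "\<forall>v\<in>h. pos n c v < k"
    and h': "h' \<in> Hnr n r" "\<forall>v\<in>h'. k \<le> pos n c v" and zero: "pos n c 0 < k"
  shows False
proof -
  define d where "d = c mod n"
  have "d < n" using n by (simp add: d_def)
  have p: "pos n c v = (if v + d < n then v + d else v + d - n)" if "v < n" for v
  proof -
    have "pos n c v = (v + d) mod n" by (simp add: d_def pos_def mod_add_right_eq)
    then show ?thesis using mod_less_double[of "v + d" n] that \<open>d < n\<close> by simp
  qed
  have "d < k" using zero p[of 0] n \<open>d < n\<close> by simp
  have "0 \<notin> h'" using h'(2) zero by force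
  then obtain j m where jm: "1 \<le> j" "j \<le> r - 1" "j \<in> h'" "m \<in> h'" "n - r + j \<le> m" "m \<le> n - 1"
    using h'(1) by (auto simp: Hnr_def)
  have "h' \<subseteq> {0..<n}" using h'(1) Hnr_subset by (auto simp: r_sets_def)
  then have jn: "j < n" "m < n" using jm by auto
  have m: "k \<le> pos n c m" "k \<le> pos n c j" using h'(2) jm by auto
  \<comment> \<open>Coordinates that wrap around are below \<open>d < k\<close>, hence on the arc;
    so neither \<open>m\<close> nor \<open>j\<close> wraps.\<close>
  have "m + d < n" using m(1) p[OF jn(2)] \<open>d < k\<close> jn by (auto split: if_splits)
  moreover have "k \<le> j + d" using m(2) p[OF jn(1)] \<open>d < k\<close> by (auto split: if_splits)
  ultimately have "k < r" using jm by linarith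
  have "card h \<le> card {..<k}"
  proof (rule card_inj_on_le)
    show "inj_on (pos n c) h"
      using h(1) pos_bij[OF n, of c] by (auto simp: r_sets_def bij_betw_def intro: inj_on_subset)
  qed (use h(2) in auto)
  with h(1) \<open>k < r\<close> show False by (simp add: r_sets_def)
qed

text \<open>Crossing: one side of any cut contains 0, and \<open>Hnr_no_split\<close> applies to it.
  Maximality: a non-edge lies in a stretch from \<open>a\<close> to \<open>b\<close> that leaves at
  least \<open>r\<close> vertices outside, including 0, and these contain an edge through 0.\<close>

lemma maximal_crossing_Hnr:
  assumes "2 \<le> r" "2 * r \<le> n"
  shows "maximal_crossing n r (Hnr n r)"
proof
  have n: "n > 0" using assms by simp
  fix e e' assume e: "e \<in> Hnr n r" "e' \<in> Hnr n r"
  show "\<not> separated n e e'"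
  proof
    assume "separated n e e'"
    then obtain c k where ck: "k \<le> n" "\<forall>v\<in>e. pos n c v < k" "\<forall>v\<in>e'. k \<le> pos n c v"
      by (auto simp: separated_def)
    show False
    proof (cases "pos n c 0 < k")
      case True
      then show False using Hnr_no_split[OF n _ ck(2) e(2) ck(3)] e Hnr_subset by blast
    next
      case False
      note pc = pos_complement[OF n ck(1), of c]
      have "\<forall>v\<in>e'. pos n (c + (n - k)) v < n - k"
      proof
        fix v assume "v \<in> e'"
        then show "pos n (c + (n - k)) v < n - k"
          using ck(3) pc[of v] pos_less[OF n, of c v] by auto
      qed
      moreover have "\<forall>v\<in>e. n - k \<le> pos n (c + (n - k)) v"
      proof
        fix v assume "v \<in> e"
        then show "n - k \<le> pos n (c + (n - k)) v" using ck(1,2) pc[of v] by simp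
      qed
      moreover have "pos n (c + (n - k)) 0 < n - k"
        using False pc[of 0] pos_less[OF n, of c 0] by simp
      ultimately show False using Hnr_no_split[OF n _ _ e(1)] e Hnr_subset by blast
    qed
  qed
next
  have n: "n > 0" using assms by simp
  fix e assume e: "e \<in> r_sets n r" "e \<notin> Hnr n r"
  have sub: "e \<subseteq> {0..<n}" "card e = r" using e by (auto simp: r_sets_def)
  have fin: "finite e" "e \<noteq> {}" using sub assms finite_subset by fastforce+
  define a where "a = Min e"
  define b where "b = Max e"
  have ab: "a \<in> e" "b \<in> e" "\<And>p. p \<in> e \<Longrightarrow> a \<le> p \<and> p \<le> b"
    using fin by (auto simp: a_def b_def)
  have "0 \<notin> e" using e Hnr_contains_0 by blast
  then have "a > 0" using ab(1) by (metis gr0I)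
  have bn: "b < n" "a < n" using ab sub by auto
  \<comment> \<open>Otherwise \<open>j = a\<close>, together with \<open>b\<close>, would witness
    membership in \<open>Hnr n r\<close>.\<close>
  have gap: "b < n - r + a"
  proof (rule ccontr)
    assume "\<not> ?thesis"
    then have "a \<in> {1..r-1}" "b \<in> {n - r + a..n - 1}" using bn \<open>a > 0\<close> assms by auto
    then have "e \<in> Hnr n r" using e(1) ab(1,2) unfolding Hnr_def by blast
    with e show False by simp
  qed
  define Z where "Z = {1..<n} - {a..b}"
  have "card Z = n - 1 - (b - a + 1)"
    unfolding Z_def using \<open>a > 0\<close> bn ab(3)[OF ab(1)] by (subst card_Diff_subset) auto
  then have "r - 1 \<le> card Z" using gap ab(3)[OF ab(1)] assms by linarith
  then obtain t where t: "t \<subseteq> Z" "card t = r - 1" "finite t"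
    by (meson obtain_subset_with_card_n)
  have "0 \<notin> t" using t(1) by (auto simp: Z_def)
  then have "card (insert 0 t) = r" using t assms by simp
  then have h: "insert 0 t \<in> Hnr n r"
    using t n by (intro Hnr_contains_0) (auto simp: r_sets_def Z_def)
  have p: "pos n (0 + (n - a)) v = (if v < a then v + n - a else v - a)" if "v < n" for v
    using pos_complement[OF n, of a 0 v] bn that by (simp add: pos_def)
  have "separated n e (insert 0 t)"
    unfolding separated_def
  proof (intro exI conjI ballI)
    show "b - a + 1 \<le> n" using bn by simp
    show "pos n (0 + (n - a)) v < b - a + 1" if "v \<in> e" for v
      using p[of v] ab(3)[OF that] bn by (simp add: less_Suc_eq_le diff_le_mono)
    show "b - a + 1 \<le> pos n (0 + (n - a)) v" if "v \<in> insert 0 t" for v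
    proof -
      have "v < n" "v < a \<or> b < v" using that t(1) n \<open>a > 0\<close> by (auto simp: Z_def)
      then show ?thesis using p[of v] bn ab(3)[OF ab(1)] by auto
    qed
  qed
  then show "\<exists>h\<in>Hnr n r. separated n h e" using h separated_sym[OF n] by blast
qed (use assms Hnr_subset in auto)

text \<open>For \<open>r \<le> k\<close>, each of the \<open>k\<close> arcs of length
  \<open>k\<close> through vertex 0 contains an \<open>r\<close>-set through 0.\<close>

lemma num_full_Hnr_ge:
  assumes "2 \<le> r" "r \<le> k" "k \<le> n"
  shows "k \<le> num_full n (Hnr n r) k"
proof -
  have n: "n > 0" using assms by simp
  have "full n (Hnr n r) d k" if d: "d < k" for d
  proof -
    have "r - 1 \<le> card ({..<k} - {d})" using assms d by simp
    then obtain t where t: "t \<subseteq> {..<k} - {d}" "card t = r - 1" "finite t"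
      by (meson obtain_subset_with_card_n)
    have "insert d t \<subseteq> {..<n}" using t d assms by auto
    then obtain e where e: "e \<subseteq> {0..<n}" "pos n d ` e = insert d t" "card e = card (insert d t)"
      using ex_preimage[OF n] by metis
    have "d \<notin> t" using t by auto
    then have "card e = r" using e(3) t assms by simp
    then have er: "e \<in> r_sets n r" using e by (simp add: r_sets_def)
    \<comment> \<open>The arcs through 0 are indexed by the coordinate \<open>d < k\<close> that 0
      has on them.\<close>
    have "pos n d 0 = d" using d assms by (simp add: pos_def)
    obtain v where v: "v \<in> e" "pos n d v = d" using e(2) by (metis imageE insertI1)
    then have "v = 0"
      using \<open>pos n d 0 = d\<close> pos_bij[OF n, of d] e(1) n
      by (auto simp: bij_betw_def inj_on_def)
    then have "e \<in> Hnr n r" using Hnr_contains_0[OF er] v by simp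
    moreover have "\<forall>v\<in>e. pos n d v < k"
    proof
      fix v assume "v \<in> e"
      then have "pos n d v \<in> insert d t" using e(2) by blast
      then show "pos n d v < k" using t(1) d by auto
    qed
    ultimately show ?thesis unfolding full_def by blast
  qed
  then have "{..<k} \<subseteq> {c. c < n \<and> full n (Hnr n r) c k}" using assms by auto
  then have "card {..<k} \<le> num_full n (Hnr n r) k" unfolding num_full_def by (intro card_mono) auto
  then show ?thesis by simp
qed

text \<open>Katona's bound \<open>k\<close> is attained by \<open>Hnr n r\<close>, so
  \<open>card_comparison\<close> applies; by its strict form, equal size leaves no deficit at
  \<open>k = r\<close>.\<close>

lemma card_Hnr_le:
  assumes "maximal_crossing n r H"
  shows "card (Hnr n r) \<le> card H"
    and "3 \<le> r \<Longrightarrow> 2 * r < n \<Longrightarrow> card H = card (Hnr n r) \<Longrightarrow> r \<le> num_full n H r"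
proof -
  interpret maximal_crossing n r H by fact
  note comparison = card_comparison[OF assms maximal_crossing_Hnr[OF r2 n2r]]
  have le: "num_full n H k \<le> num_full n (Hnr n r) k" if "r \<le> k" "2 * k \<le> n" for k
    using num_full_le[OF that(2)] num_full_Hnr_ge[of r k n] r2 that by linarith
  show "card (Hnr n r) \<le> card H" by (rule comparison(1)[OF le])
  assume r: "3 \<le> r" "2 * r < n" "card H = card (Hnr n r)"
  then have "\<not> num_full n H r < num_full n (Hnr n r) r" using comparison(2)[OF le] by auto
  then show "r \<le> num_full n H r" using num_full_Hnr_ge[of r r n] r2 n2r by linarith
qed

lemma sat_cyc_eq_card_Hnr:
  assumes "2 \<le> r" "2 * r \<le> n"
  shows "sat_cyc n r (2 * r) (M1 r) = card (Hnr n r)"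
  unfolding sat_cyc_def saturated_M1_iff[OF assms]
proof (rule Min_eqI)
  have "{H. maximal_crossing n r H} \<subseteq> Pow (r_sets n r)"
    using maximal_crossing.r_sets by auto
  then show "finite (card ` {H. maximal_crossing n r H})"
    by (simp add: finite_r_sets finite_subset)
qed (use maximal_crossing_Hnr[OF assms] card_Hnr_le(1) in auto)

section \<open>The case \<open>r = 2\<close>\<close>

text \<open>All weights are \<open>(k - 2) choose 0 = 1\<close>, so each of the \<open>n - 3\<close>
  terms of the doubled count equals \<open>n\<close>, whatever \<open>H\<close> is.\<close>

lemma card_saturated_2:
  assumes "maximal_crossing n 2 H"
  shows "card H = n"
proof -
  interpret maximal_crossing n 2 H by fact
  have "2 * card (r_sets n 2 - H) = (\<Sum>k=2..n-2. n)"
    unfolding twice_card_nonedges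
    by (rule sum.cong) (use num_full_add in \<open>auto simp: add.commute\<close>)
  also have "\<dots> = (n - 3) * n" using n2r by simp
  finally have "2 * card (r_sets n 2 - H) = (n - 3) * n" .
  moreover have "2 * (n choose 2) = n * (n - 1)" using times_binomial_minus1_eq[of 2 n] by simp
  moreover have "(n - 3) * n + 2 * n = n * (n - 1)"
  proof -
    obtain m where "n = 3 + m" using n2r le_Suc_ex[of 3 n] by auto
    then show ?thesis by (simp add: algebra_simps)
  qed
  ultimately show ?thesis using card_edges by linarith
qed

section \<open>The case \<open>r = 3\<close>: size and uniqueness\<close>

lemma mem_Hnr_3_iff:
  assumes "6 \<le> n"
  shows "h \<in> Hnr n 3 \<longleftrightarrow> h \<subseteq> {0..<n} \<and> card h = 3 \<and>
    (0 \<in> h \<or> 1 \<in> h \<and> (n - 2 \<in> h \<or> n - 1 \<in> h) \<or> 2 \<in> h \<and> n - 1 \<in> h)"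
proof -
  have I: "{n - 3 + 1..n - 1} = {n - 2, n - 1}" "{n - 3 + 2..n - 1} = {n - 1}" "{1..3 - 1} = {1, 2::nat}"
    using assms by auto
  show ?thesis unfolding Hnr_def r_sets_def I(3) UN_insert UN_empty I(1,2) by auto
qed

lemma card_Hnr_3:
  assumes "6 \<le> n"
  shows "card (Hnr n 3) = ((n - 1) choose 2) + 3 * n - 11"
proof -
  let ?S = "\<lambda>S A. {h. S \<subseteq> h \<and> h \<subseteq> A \<and> card h = (3::nat)}"
  \<comment> \<open>Each piece leaves out the triples counted before it: 0 is excluded from the last
    three, \<open>n - 2\<close> from \<open>B2\<close>, and 1, which \<open>B1\<close> and
    \<open>B2\<close> contain, from \<open>B3\<close>.\<close>
  define A where "A = ?S {0} {0..<n}"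
  define B1 where "B1 = ?S {1, n - 2} {1..<n}"
  define B2 where "B2 = ?S {1, n - 1} ({1..<n} - {n - 2})"
  define B3 where "B3 = ?S {2, n - 1} ({1..<n} - {1})"
  note defs = A_def B1_def B2_def B3_def
  have sub1: "h \<subseteq> {1..<n} \<longleftrightarrow> h \<subseteq> {0..<n} \<and> 0 \<notin> h" for h
    by (auto simp: subset_iff) (metis Suc_leI gr0I)
  have "h \<in> A \<union> (B1 \<union> (B2 \<union> B3)) \<longleftrightarrow> h \<subseteq> {0..<n} \<and> card h = 3 \<and>
      (0 \<in> h \<or> 1 \<in> h \<and> (n - 2 \<in> h \<or> n - 1 \<in> h) \<or> 2 \<in> h \<and> n - 1 \<in> h)" for h
    unfolding defs Un_iff mem_Collect_eq insert_subset subset_Diff_insert Diff_empty sub1 by blast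
  then have eq: "Hnr n 3 = A \<union> (B1 \<union> (B2 \<union> B3))" using mem_Hnr_3_iff[OF assms] by blast
  have fin: "finite A" "finite B1" "finite B2" "finite B3"
    unfolding defs by (auto intro: finite_subset[of _ "Pow {0..<n}"])
  have cards: "card A = (n - 1) choose 2" "card B1 = n - 3" "card B2 = n - 4" "card B3 = n - 4"
    unfolding defs using assms by (subst card_supersets; auto)+
  have "card (Hnr n 3) = card A + (card B1 + (card B2 + card B3))"
    unfolding eq
    by (subst card_Un_disjoint; (simp add: fin)?; (auto simp: defs)?)+
  with cards assms show ?thesis by linarith
qed

text \<open>Every edge meets each of three consecutive full arcs of length 3. After rotation this is
  the membership condition of \<open>Hnr n 3\<close>, and equal size turns the inclusion into
  equality.\<close>

lemma card_minimal_3_iso: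
  assumes n: "6 < n" and mc: "maximal_crossing n 3 H" and card: "card H = card (Hnr n 3)"
  shows "cgh_iso n H (Hnr n 3)"
proof -
  interpret maximal_crossing n 3 H by fact
  have "3 \<le> num_full n H 3" using card_Hnr_le(2)[OF mc] n card by simp
  then obtain c where c: "full n H c 3" "full n H (c + 1) 3" "full n H (c + 2) 3"
    using three_consecutive_full[OF n] by blast
  let ?f = "pos n c"
  have bij: "bij_betw ?f {0..<n} {0..<n}" by (rule pos_bij[OF n_pos])
  have sub: "(`) ?f ` H \<subseteq> Hnr n 3"
  proof (rule image_subsetI)
    fix e assume e: "e \<in> H"
    then have e': "e \<subseteq> {0..<n}" "card e = 3" using r_sets by (auto simp: r_sets_def)
    have P: "?f ` e \<in> r_sets n 3"
      using e' bij pos_less[OF n_pos, of c]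
      by (auto simp: r_sets_def card_image bij_betw_def inj_on_subset)
    have shift: "pos n (c + d) v = (if ?f v + d < n then ?f v + d else ?f v + d - n)" if "d \<le> 2" for d v
      using pos_add_if[OF n_pos, of d c v] that n by simp
    obtain v1 where v1: "v1 \<in> e" "?f v1 < 3" using edge_meets_full[OF c(1) _ e] n by auto
    obtain v2 where v2: "v2 \<in> e" "pos n (c + 1) v2 < 3" using edge_meets_full[OF c(2) _ e] n by auto
    obtain v3 where v3: "v3 \<in> e" "pos n (c + 2) v3 < 3" using edge_meets_full[OF c(3) _ e] n by auto
    have "?f v1 \<in> {0, 1, 2}" "?f v2 \<in> {n - 1, 0, 1}" "?f v3 \<in> {n - 2, n - 1, 0}"
      using v1(2) v2(2) v3(2) shift[of 1 v2] shift[of 2 v3] pos_less[OF n_pos, of c v2]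
        pos_less[OF n_pos, of c v3] n by (auto split: if_splits)
    moreover have "?f v1 \<in> ?f ` e" "?f v2 \<in> ?f ` e" "?f v3 \<in> ?f ` e" using v1 v2 v3 by auto
    \<comment> \<open>Without 0, the edge meets {1, 2}, {n - 1, 1} and {n - 2, n - 1}, which forces
      one of the three pairs.\<close>
    ultimately have "0 \<in> ?f ` e \<or> 1 \<in> ?f ` e \<and> (n - 2 \<in> ?f ` e \<or> n - 1 \<in> ?f ` e) \<or> 2 \<in> ?f ` e \<and> n - 1 \<in> ?f ` e"
      using n by (metis (no_types) empty_iff insert_iff)
    then show "?f ` e \<in> Hnr n 3" unfolding mem_Hnr_3_iff[OF less_imp_le[OF n]]
      using P by (simp add: r_sets_def)
  qed
  have "inj_on ((`) ?f) H"
    using bij r_sets by (auto simp: r_sets_def bij_betw_def intro!: inj_on_subset[OF inj_on_image_Pow])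
  then have "card ((`) ?f ` H) = card (Hnr n 3)" using card by (simp add: card_image)
  then have eq: "(`) ?f ` H = Hnr n 3"
    using sub by (intro card_subset_eq) (auto intro: finite_subset[OF Hnr_subset finite_r_sets])
  have "cyc_order_pres n n ?f"
  proof -
    \<comment> \<open>The rotation by \<open>d\<close> undoes \<open>?f\<close> and so witnesses
      that cyclic order is preserved.\<close>
    obtain d where d: "d < n" "\<And>v. pos n 0 v = pos n (c + d) v" using shift_exists[OF n_pos, of 0 c] by metis
    have "(?f v + d) mod n = v" if "v < n" for v
      using d(2)[of v] that by (simp add: pos_add) (simp add: pos_def)
    then show ?thesis unfolding cyc_order_pres_def by (intro exI[of _ d]) auto
  qed
  with bij eq show ?thesis unfolding cgh_iso_def by blast
qed

section \<open>Asymptotics and conclusion\<close>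

text \<open>The edges through 0 give the main term. Every other edge contains one of at most
  \<open>r * r\<close> pairs \<open>{j, m}\<close>, and each pair lies in
  \<open>(n - 2) choose (r - 2)\<close> sets.\<close>

lemma card_Hnr_bounds:
  assumes "2 \<le> r" "2 * r \<le> n"
  shows "(n - 1) choose (r - 1) \<le> card (Hnr n r)"
    and "card (Hnr n r) \<le> ((n - 1) choose (r - 1)) + r * r * ((n - 2) choose (r - 2))"
proof -
  let ?S = "\<lambda>S. {h. S \<subseteq> h \<and> h \<subseteq> {0..<n} \<and> card h = r}"
  \<comment> \<open>The range of \<open>m\<close> is that for \<open>j = 1\<close>, which contains
    the ranges for all other \<open>j\<close>.\<close>
  let ?J = "{1..r-1} \<times> {n-r+1..n-1}"
  have c0: "card (?S {0}) = (n - 1) choose (r - 1)"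
    using card_supersets[of "{0..<n}" "{0}" r] assms by simp
  have fin: "finite (Hnr n r)" using Hnr_subset finite_r_sets finite_subset by blast
  have finS: "finite (?S S)" for S by (rule finite_subset[of _ "Pow {0..<n}"]) auto
  have "?S {0} \<subseteq> Hnr n r" by (auto simp: Hnr_def r_sets_def)
  then show "(n - 1) choose (r - 1) \<le> card (Hnr n r)" using c0 card_mono[OF fin] by metis
  have "Hnr n r \<subseteq> ?S {0} \<union> (\<Union>(j, m)\<in>?J. ?S {j, m})"
  proof
    fix h assume "h \<in> Hnr n r"
    then have "h \<in> r_sets n r" "0 \<in> h \<or> (\<exists>j\<in>{1..r-1}. j \<in> h \<and> (\<exists>m\<in>{n-r+j..n-1}. m \<in> h))"
      unfolding Hnr_def by blast+
    then consider "h \<in> r_sets n r" "0 \<in> h"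
      | j m where "h \<in> r_sets n r" "j \<in> {1..r-1}" "j \<in> h" "m \<in> h" "m \<in> {n-r+j..n-1}"
      by blast
    then show "h \<in> ?S {0} \<union> (\<Union>(j, m)\<in>?J. ?S {j, m})"
    proof cases
      case 1
      then show ?thesis by (simp add: r_sets_def)
    next
      case 2
      then have "(j, m) \<in> ?J" "h \<in> ?S {j, m}" by (auto simp: r_sets_def)
      then show ?thesis by blast
    qed
  qed
  then have "card (Hnr n r) \<le> card (?S {0} \<union> (\<Union>(j, m)\<in>?J. ?S {j, m}))"
    using finS by (intro card_mono) auto
  also have "\<dots> \<le> card (?S {0}) + card (\<Union>(j, m)\<in>?J. ?S {j, m})" by (rule card_Un_le)
  also have "card (\<Union>(j, m)\<in>?J. ?S {j, m}) \<le> (\<Sum>i\<in>?J. card (case i of (j, m) \<Rightarrow> ?S {j, m}))"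
    by (rule card_UN_le) simp
  also have "\<dots> = (\<Sum>i\<in>?J. (n - 2) choose (r - 2))"
  proof (rule sum.cong[OF refl])
    fix i assume "i \<in> ?J"
    then obtain j m where i: "i = (j, m)" "j \<in> {1..r-1}" "m \<in> {n-r+1..n-1}" by auto
    then have "card {j, m} = 2" "{j, m} \<subseteq> {0..<n}" using assms by auto
    then show "card (case i of (j, m) \<Rightarrow> ?S {j, m}) = (n - 2) choose (r - 2)"
      using card_supersets[of "{0..<n}" "{j, m}" r] assms i(1) by simp
  qed
  also have "\<dots> = card ?J * ((n - 2) choose (r - 2))" by simp
  also have "card ?J \<le> r * r" using assms by (simp add: card_cartesian_product mult_le_mono)
  finally show "card (Hnr n r) \<le> ((n - 1) choose (r - 1)) + r * r * ((n - 2) choose (r - 2))"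
    using c0 by simp
qed

text \<open>Relative to \<open>n choose (r - 1)\<close>, the main term is
  \<open>1 - (r - 1) / n\<close> and the error is at most \<open>r * r * r / n\<close>; a squeeze
  gives the limit 1.\<close>

lemma card_Hnr_asymp:
  assumes "2 \<le> r"
  shows "(\<lambda>n. real (card (Hnr n r))) \<sim>[at_top] (\<lambda>n. real (n choose (r - 1)))"
proof (rule asymp_equivI', rule tendsto_sandwich)
  let ?q = "\<lambda>n. real (card (Hnr n r)) / real (n choose (r - 1))"
  have ev: "eventually (\<lambda>n. n \<ge> 2 * r) at_top" by (rule eventually_ge_at_top)
  have bounds: "1 - real r / real n \<le> ?q n \<and> ?q n \<le> 1 + real (r * r * r) / real n" if n: "n \<ge> 2 * r" for n
  proof -
    define C where "C = real (n choose (r - 1))"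
    have "n > 0" using n assms by simp
    have "C > 0" using n assms by (simp add: C_def)
    have C1: "real ((n - 1) choose (r - 1)) = (1 - real (r - 1) / real n) * C"
    proof -
      have "real (n - (r - 1)) * C = real n * real ((n - 1) choose (r - 1))"
        unfolding C_def by (simp only: of_nat_mult[symmetric] binomial_absorb_comp)
      moreover have "real (n - (r - 1)) = real n - real (r - 1)" using n by (intro of_nat_diff) simp
      ultimately show ?thesis using \<open>n > 0\<close> by (simp add: field_simps)
    qed
    have C2: "real ((n - 2) choose (r - 2)) \<le> real r / real n * C"
    proof -
      have "real (r - 1) * C = real n * real ((n - 1) choose (r - 1 - 1))"
        unfolding C_def of_nat_mult[symmetric] using times_binomial_minus1_eq[of "r - 1" n] assms by simp
      moreover have "(n - 2) choose (r - 2) \<le> (n - 1) choose (r - 1 - 1)"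
        using binomial_right_mono[of "n - 2" "n - 1" "r - 2"] by (simp add: numeral_2_eq_2)
      ultimately have "real n * real ((n - 2) choose (r - 2)) \<le> real (r - 1) * C"
        using \<open>n > 0\<close> by simp
      also have "\<dots> \<le> real r * C" using \<open>C > 0\<close> by simp
      finally show ?thesis using \<open>n > 0\<close> by (simp add: field_simps)
    qed
    have "real (card (Hnr n r)) \<le> real ((n - 1) choose (r - 1)) + real (r * r) * real ((n - 2) choose (r - 2))"
      unfolding of_nat_mult[symmetric] of_nat_add[symmetric] of_nat_le_iff
      by (rule card_Hnr_bounds(2)[OF assms n])
    also have "\<dots> \<le> 1 * C + real (r * r) * (real r / real n * C)"
      unfolding C1 by (intro add_mono mult_left_mono mult_right_mono C2) (use \<open>C > 0\<close> in auto)
    finally have up: "real (card (Hnr n r)) \<le> (1 + real (r * r * r) / real n) * C"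
      by (simp add: algebra_simps)
    have "(1 - real r / real n) * C \<le> (1 - real (r - 1) / real n) * C"
      using \<open>C > 0\<close> by (intro mult_right_mono) (auto simp: divide_right_mono)
    also have "\<dots> \<le> real (card (Hnr n r))"
      unfolding C1[symmetric] of_nat_le_iff by (rule card_Hnr_bounds(1)[OF assms n])
    finally show ?thesis using up \<open>C > 0\<close>
      unfolding C_def by (simp add: pos_le_divide_eq pos_divide_le_eq)
  qed
  show "eventually (\<lambda>n. 1 - real r / real n \<le> ?q n) at_top"
    "eventually (\<lambda>n. ?q n \<le> 1 + real (r * r * r) / real n) at_top"
    using ev by (eventually_elim, use bounds in blast)+
  have inv: "(\<lambda>n. x / real n) \<longlonglongrightarrow> 0" for x :: real
    by (rule lim_const_over_n)
  show "(\<lambda>n. 1 - real r / real n) \<longlonglongrightarrow> 1" using tendsto_diff[OF tendsto_const inv] by simp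
  show "(\<lambda>n. 1 + real (r * r * r) / real n) \<longlonglongrightarrow> 1"
    using tendsto_add[OF tendsto_const inv] by simp
qed

theorem theorem1p1:
  shows "(\<forall>r\<ge>2. (\<lambda>n. real (sat_cyc n r (2*r) (M1 r))) \<sim>[at_top] (\<lambda>n. real (n choose (r-1))))
    \<and> (\<forall>n\<ge>4. \<forall>H. saturated n 2 4 (M1 2) H \<longrightarrow> card H = n)
    \<and> (\<forall>n\<ge>6. sat_cyc n 3 6 (M1 3) = ((n-1) choose 2) + 3*n - 11)
    \<and> (\<forall>n>6. saturated n 3 6 (M1 3) (Hnr n 3)
             \<and> card (Hnr n 3) = ((n-1) choose 2) + 3*n - 11
             \<and> (\<forall>H. saturated n 3 6 (M1 3) H \<and> card H = ((n-1) choose 2) + 3*n - 11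
                    \<longrightarrow> cgh_iso n H (Hnr n 3)))"
proof (intro conjI allI impI)
  fix r :: nat assume r: "2 \<le> r"
  \<comment> \<open>The value of \<open>sat_cyc\<close> is established only for
    \<open>n \<ge> 2 * r\<close>, which suffices in the limit.\<close>
  have "eventually (\<lambda>n. real (sat_cyc n r (2*r) (M1 r)) = real (card (Hnr n r))) at_top"
    using eventually_ge_at_top[of "2 * r"] by eventually_elim (simp add: sat_cyc_eq_card_Hnr[OF r])
  from asymp_equiv_cong[OF this always_eventually[OF allI[OF refl]]] card_Hnr_asymp[OF r]
  show "(\<lambda>n. real (sat_cyc n r (2*r) (M1 r))) \<sim>[at_top] (\<lambda>n. real (n choose (r-1)))" by simp
next
  fix n :: nat and H assume "4 \<le> n" "saturated n 2 4 (M1 2) H"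
  then show "card H = n" using saturated_M1_iff[of 2 n H] card_saturated_2 by simp
next
  fix n :: nat assume "6 \<le> n"
  then show "sat_cyc n 3 6 (M1 3) = ((n-1) choose 2) + 3*n - 11"
    using sat_cyc_eq_card_Hnr[of 3 n] card_Hnr_3[of n] by simp
next
  fix n :: nat assume "6 < n"
  then show "saturated n 3 6 (M1 3) (Hnr n 3)"
    using saturated_M1_iff[of 3 n "Hnr n 3"] maximal_crossing_Hnr[of 3 n] by simp
next
  fix n :: nat assume "6 < n"
  then show "card (Hnr n 3) = ((n-1) choose 2) + 3*n - 11" using card_Hnr_3[of n] by simp
next
  fix n :: nat and H
  assume n: "6 < n" and H: "saturated n 3 6 (M1 3) H \<and> card H = ((n-1) choose 2) + 3*n - 11"
  then have "maximal_crossing n 3 H" using saturated_M1_iff[of 3 n H] by simp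
  moreover have "card H = card (Hnr n 3)" using n H card_Hnr_3[of n] by simp
  ultimately show "cgh_iso n H (Hnr n 3)" by (rule card_minimal_3_iso[OF n])
qed

end
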